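(* For any non-negative integers $d$ and $k$, the convex hull of any finite set of points on the curve $\mu_{d,k}(t)$ in the range $0<t<2\pi$ is a $(d+2k)$-dimensional cyclic polytope.
   Context: The mixed moment curve is $\mu_{d,k}(t) = (t, t^2, \dots, t^d, \cos t, \sin t, \cos 2t, \sin 2t, \dots, \cos kt, \sin kt)\in\mathbb{R}^{2k+d}$. A $D$-dimensional cyclic polytope is a convex polytope that is combinatorially equivalent (has isomorphic face lattice) to the convex hull of a finite set of points on the standard moment curve $(t,t^2,\dots,t^D)\in\mathbb{R}^D$. *)

theory Defs
  imports "HOL-Analysis.Analysis" "HOL-Library.Function_Algebras"
begin

text \<open>
  Since the dimension is a natural number (possibly zero) computed from other parameters,
  \<open>\<real>\<^sup>D\<close> is represented as in \<^const>\<open>Euclidean_space\<close>: by the functions \<open>nat \<Rightarrow> real\<close> that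
  vanish from index \<open>D\<close> on. The pointwise vector space structure makes the library's
  \<open>convex hull\<close>, \<^const>\<open>polytope\<close> and \<^const>\<open>face_of\<close> applicable; all three are intrinsic
  to a convex set, so it does not matter that the type itself is infinite-dimensional.
\<close>

instantiation "fun" :: (type, real_vector) real_vector
begin

definition scaleR_fun_def: "c *\<^sub>R f = (\<lambda>x. c *\<^sub>R f x)"

instance
  by standard (simp_all add: scaleR_fun_def fun_eq_iff scaleR_add_right scaleR_add_left)

end

lemma scaleR_fun_apply [simp]: "(c *\<^sub>R f) x = c *\<^sub>R f x"
  by (simp add: scaleR_fun_def)

text \<open>Coordinates are numbered from 0, so coordinate \<open>i\<close> of the moment curve is \<open>t\<^bsup>i+1\<^esup>\<close>.\<close>

definition moment_curve :: "nat \<Rightarrow> real \<Rightarrow> (nat \<Rightarrow> real)" where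
  "moment_curve D t = (\<lambda>i. if i < D then t ^ (i + 1) else 0)"

definition mixed_moment_curve :: "nat \<Rightarrow> nat \<Rightarrow> real \<Rightarrow> (nat \<Rightarrow> real)" where
  "mixed_moment_curve d k t = (\<lambda>i.
     if i < d then t ^ (i + 1)
     else if i < d + 2 * k then
       (let j = (i - d) div 2 + 1
        in if even (i - d) then cos (real j * t) else sin (real j * t))
     else 0)"

lemma moment_curve_in_Euclidean_space:
  "moment_curve D t \<in> topspace (Euclidean_space D)"
  by (simp add: topspace_Euclidean_space moment_curve_def)

lemma mixed_moment_curve_in_Euclidean_space:
  "mixed_moment_curve d k t \<in> topspace (Euclidean_space (d + 2 * k))"
  by (simp add: topspace_Euclidean_space mixed_moment_curve_def)

lemma mixed_moment_curve_power:
  "i \<in> {1..d} \<Longrightarrow> mixed_moment_curve d k t (i - 1) = t ^ i"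
  by (auto simp: mixed_moment_curve_def)

lemma mixed_moment_curve_cos:
  "j \<in> {1..k} \<Longrightarrow> mixed_moment_curve d k t (d + 2 * (j - 1)) = cos (real j * t)"
  by (auto simp: mixed_moment_curve_def)

lemma mixed_moment_curve_sin:
  "j \<in> {1..k} \<Longrightarrow> mixed_moment_curve d k t (d + 2 * (j - 1) + 1) = sin (real j * t)"
  by (auto simp: mixed_moment_curve_def)

text \<open>
  The face lattice of \<open>P\<close> is \<open>{F. F face_of P}\<close> ordered by inclusion; it contains the improper
  faces \<open>{}\<close> and \<open>P\<close>.
\<close>

definition combinatorially_equivalent ::
    "'a::real_vector set \<Rightarrow> 'b::real_vector set \<Rightarrow> bool" where
  "combinatorially_equivalent P Q \<longleftrightarrow>
     (\<exists>\<phi>. bij_betw \<phi> {F. F face_of P} {G. G face_of Q} \<and>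
        (\<forall>F F'. F face_of P \<longrightarrow> F' face_of P \<longrightarrow> (F \<subseteq> F' \<longleftrightarrow> \<phi> F \<subseteq> \<phi> F')))"

text \<open>
  As \<open>T\<close> is an arbitrary finite set, \<open>D\<close> is the dimension of the polytope only if it has at least
  \<open>D + 1\<close> vertices; with fewer vertices it is a simplex, and it may be empty.
\<close>

definition cyclic_polytope :: "nat \<Rightarrow> 'a::real_vector set \<Rightarrow> bool" where
  "cyclic_polytope D P \<longleftrightarrow> polytope P \<and>
     (\<exists>T::real set. finite T \<and>
        combinatorially_equivalent P (convex hull (moment_curve D ` T)))"

end

theory Submission
  imports Defs
begin

text \<open>
  The face lattice of \<open>conv (f ` T)\<close> depends only on the signs of the affine dependencies of
  \<open>f\<close> on \<open>T\<close>: the faces correspond to the sets \<open>Y \<subseteq> T\<close> such that every dependency with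
  negative part in \<open>Y\<close> has positive part in \<open>Y\<close>. If no hyperplane meets the curve \<open>f\<close> in more
  than \<open>D\<close> points, then every \<open>D + 1\<close> points are affinely independent and the dependency of
  \<open>D + 2\<close> points alternates in sign along the curve. As every dependency can be reduced to such a
  circuit, all these curves give the same face lattice for the same \<open>T\<close>. For the mixed moment curve
  the hyperplane condition follows by differentiating \<open>d\<close> times (Rolle), which leaves a trigonometric
  polynomial of degree \<open>k\<close> with at most \<open>2k\<close> zeros. The moment curve is the case \<open>k = 0\<close>.
\<close>

section \<open>Homogeneous linear systems\<close>

text \<open>Gaussian elimination by induction on the equations \<open>B\<close>: an unknown with a
  nonzero coefficient in equation \<open>b\<close> is solved for and eliminated from the
  others.\<close>

lemma underdetermined_system:
  fixes M :: "'a \<Rightarrow> 'b \<Rightarrow> real"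
  assumes "finite B" "finite A" "card B < card A"
  shows "\<exists>c. (\<forall>b\<in>B. (\<Sum>a\<in>A. c a * M a b) = 0) \<and> (\<exists>a\<in>A. c a \<noteq> 0)"
  using assms
proof (induction B arbitrary: A M rule: finite_induct)
  case empty
  then have "A \<noteq> {}" by auto
  then show ?case by (intro exI[of _ "\<lambda>_. 1"]) auto
next
  case (insert b B)
  show ?case
  proof (cases "\<forall>a\<in>A. M a b = 0")
    case True
    from insert have "card B < card A" by simp
    from insert.IH[OF insert.prems(1) this, of M] obtain c
      where c: "\<forall>b\<in>B. (\<Sum>a\<in>A. c a * M a b) = 0" "\<exists>a\<in>A. c a \<noteq> 0" by blast
    then show ?thesis using True by (intro exI[of _ c]) auto
  next
    case False
    then obtain p where p: "p \<in> A" "M p b \<noteq> 0" by blast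
    define A' where "A' = A - {p}"
    have A': "finite A'" "card B < card A'" "A = insert p A'" "p \<notin> A'"
      using insert p by (auto simp: A'_def)
    \<comment> \<open>These are the coefficients after solving equation \<open>b\<close> for the
      unknown \<open>p\<close> and substituting; \<open>q\<close> below is the value this forces on
      \<open>p\<close>.\<close>
    from insert.IH[OF A'(1,2), of "\<lambda>a y. M a y - M a b / M p b * M p y"] obtain c
      where c: "\<forall>y\<in>B. (\<Sum>a\<in>A'. c a * (M a y - M a b / M p b * M p y)) = 0"
        and nz: "\<exists>a\<in>A'. c a \<noteq> 0" by blast
    define q where "q = - (\<Sum>a\<in>A'. c a * M a b) / M p b"
    define c' where "c' = c(p := q)"
    have sum': "(\<Sum>a\<in>A. c' a * M a y) = q * M p y + (\<Sum>a\<in>A'. c a * M a y)" for y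
    proof -
      have "(\<Sum>a\<in>A'. c' a * M a y) = (\<Sum>a\<in>A'. c a * M a y)"
        using A' by (intro sum.cong) (auto simp: c'_def)
      then show ?thesis using A' by (simp add: c'_def)
    qed
    have "(\<Sum>a\<in>A. c' a * M a b) = 0"
      using p by (simp add: sum' q_def)
    moreover have "(\<Sum>a\<in>A. c' a * M a y) = 0" if "y \<in> B" for y
    proof -
      have "(\<Sum>a\<in>A'. c a * (M a y - M a b / M p b * M p y)) =
          (\<Sum>a\<in>A'. c a * M a y) - (\<Sum>a\<in>A'. c a * M a b) * (M p y / M p b)"
        unfolding sum_distrib_right sum_subtractf[symmetric]
        by (intro sum.cong) (auto simp: algebra_simps)
      with c that show ?thesis by (simp add: sum' q_def)
    qed
    moreover have "\<exists>a\<in>A. c' a \<noteq> 0"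
      using nz A' by (auto simp: c'_def)
    ultimately show ?thesis by (intro exI[of _ c']) auto
  qed
qed

section \<open>Faces and affine dependencies\<close>

text \<open>The coefficients sit on parameters rather than on points, so dependencies of two curves
  can be compared on one index set; \<open>c\<close> is unconstrained outside
  \<open>A\<close>.\<close>

definition affine_relation :: "('i \<Rightarrow> 'a::real_vector) \<Rightarrow> 'i set \<Rightarrow> ('i \<Rightarrow> real) \<Rightarrow> bool" where
  "affine_relation f A c \<longleftrightarrow> sum c A = 0 \<and> (\<Sum>t\<in>A. c t *\<^sub>R f t) = 0"

lemma affine_relation_extend:
  assumes "affine_relation f A c" "A \<subseteq> T" "finite T" "\<And>t. t \<in> T - A \<Longrightarrow> c t = 0"
  shows "affine_relation f T c"
  using assms sum.mono_neutral_left[of T A c] sum.mono_neutral_left[of T A "\<lambda>t. c t *\<^sub>R f t"]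
  by (auto simp: affine_relation_def)

lemma affine_relation_restrict:
  assumes "affine_relation f T c" "A \<subseteq> T" "finite T" "\<And>t. t \<in> T - A \<Longrightarrow> c t = 0"
  shows "affine_relation f A c"
  using assms sum.mono_neutral_left[of T A c] sum.mono_neutral_left[of T A "\<lambda>t. c t *\<^sub>R f t"]
  by (auto simp: affine_relation_def)

lemma affine_relation_scale:
  "affine_relation f A c \<Longrightarrow> affine_relation f A (\<lambda>t. r * c t)"
  by (simp add: affine_relation_def flip: sum_distrib_left scaleR_scaleR scaleR_sum_right)

lemma affine_relation_diff:
  "affine_relation f A c \<Longrightarrow> affine_relation f A e \<Longrightarrow> affine_relation f A (\<lambda>t. c t - e t)"
  by (simp add: affine_relation_def sum_subtractf scaleR_left_diff_distrib)

text \<open>This is the oriented matroid description of a face. Passing to \<open>- c\<close>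
  exchanges the two signs, so the reverse implication is included.\<close>

definition relation_closed :: "('i \<Rightarrow> 'a::real_vector) \<Rightarrow> 'i set \<Rightarrow> 'i set \<Rightarrow> bool" where
  "relation_closed f T Y \<longleftrightarrow> (\<forall>c. affine_relation f T c \<longrightarrow>
     (\<forall>t\<in>T. c t < 0 \<longrightarrow> t \<in> Y) \<longrightarrow> (\<forall>t\<in>T. 0 < c t \<longrightarrow> t \<in> Y))"

section \<open>Faces of a convex hull and the parameters they contain\<close>

lemma in_convex_hull_image_iff:
  fixes f :: "'i \<Rightarrow> 'a::real_vector"
  assumes "finite T"
  shows "z \<in> convex hull (f ` T) \<longleftrightarrow>
    (\<exists>w. (\<forall>t\<in>T. 0 \<le> w t) \<and> sum w T = 1 \<and> (\<Sum>t\<in>T. w t *\<^sub>R f t) = z)"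
proof
  assume z: "z \<in> convex hull (f ` T)"
  \<comment> \<open>Since \<open>f\<close> may identify parameters, each point gets one
    representative in \<open>B\<close> that carries its whole weight.\<close>
  obtain B where B: "B \<subseteq> T" "inj_on f B" "f ` T = f ` B"
    using subset_image_inj[of "f ` T" f T] by auto
  have "finite (f ` B)" using B assms finite_subset by blast
  then obtain u where u: "\<forall>x\<in>f ` B. 0 \<le> u x" "sum u (f ` B) = 1" "(\<Sum>x\<in>f ` B. u x *\<^sub>R x) = z"
    using z by (auto simp: B(3) convex_hull_finite)
  define w where "w t = (if t \<in> B then u (f t) else 0)" for t
  have "sum w T = sum w B"
    using B assms by (intro sum.mono_neutral_right) (auto simp: w_def)
  also have "\<dots> = 1" using u(2) by (simp add: sum.reindex[OF B(2)] w_def)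
  finally have 1: "sum w T = 1" .
  have "(\<Sum>t\<in>T. w t *\<^sub>R f t) = (\<Sum>t\<in>B. w t *\<^sub>R f t)"
    using B assms by (intro sum.mono_neutral_right) (auto simp: w_def)
  also have "\<dots> = z" using u(3) by (simp add: sum.reindex[OF B(2)] w_def)
  finally show "\<exists>w. (\<forall>t\<in>T. 0 \<le> w t) \<and> sum w T = 1 \<and> (\<Sum>t\<in>T. w t *\<^sub>R f t) = z"
    using 1 u(1) by (intro exI[of _ w]) (auto simp: w_def)
next
  assume "\<exists>w. (\<forall>t\<in>T. 0 \<le> w t) \<and> sum w T = 1 \<and> (\<Sum>t\<in>T. w t *\<^sub>R f t) = z"
  then obtain w where w: "\<forall>t\<in>T. 0 \<le> w t" "sum w T = 1" "(\<Sum>t\<in>T. w t *\<^sub>R f t) = z" by blast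
  have "(\<Sum>t\<in>T. w t *\<^sub>R f t) \<in> convex hull (f ` T)"
    using w assms by (intro convex_sum) (auto intro: hull_inc)
  with w show "z \<in> convex hull (f ` T)" by simp
qed

text \<open>Splitting off \<open>f s\<close> puts the given point strictly between
  \<open>f s\<close> and the barycentre of the remaining points, and a face containing such a point
  contains both endpoints. In the degenerate cases the point is \<open>f s\<close> itself.\<close>

lemma face_of_contains_positive_weight:
  fixes f :: "'i \<Rightarrow> 'a::real_vector"
  assumes "finite T" and F: "F face_of convex hull (f ` T)"
    and w: "\<And>t. t \<in> T \<Longrightarrow> 0 \<le> w t" "sum w T = 1" "(\<Sum>t\<in>T. w t *\<^sub>R f t) \<in> F"
    and s: "s \<in> T" "0 < w s"
  shows "f s \<in> F"
proof -
  define z where "z = (\<Sum>t\<in>T. w t *\<^sub>R f t)"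
  define T' where "T' = T - {s}"
  define r where "r = sum w T'"
  have T': "finite T'" "T = insert s T'" "s \<notin> T'" using assms by (auto simp: T'_def)
  have ws: "w s = 1 - r" using w(2) T' by (simp add: r_def)
  have zs: "z = w s *\<^sub>R f s + (\<Sum>t\<in>T'. w t *\<^sub>R f t)" using T' by (simp add: z_def)
  have r0: "0 \<le> r" unfolding r_def using w(1) T' by (intro sum_nonneg) auto
  have z: "z \<in> F" using w(3) by (simp add: z_def)
  show ?thesis
  proof (cases "r = 0")
    case True
    then have "\<forall>t\<in>T'. w t = 0"
      using sum_nonneg_eq_0_iff[of T' w] w(1) T' by (auto simp: r_def)
    then have "z = f s" using zs ws True by simp
    then show ?thesis using z by simp
  next
    case False
    then have r: "0 < r" "r < 1" using r0 ws s by auto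
    define y where "y = (\<Sum>t\<in>T'. (w t / r) *\<^sub>R f t)"
    have "y \<in> convex hull (f ` T')"
      unfolding in_convex_hull_image_iff[OF T'(1)] y_def
      using w(1) T' r
      by (intro exI[of _ "\<lambda>t. w t / r"]) (auto simp: r_def simp flip: sum_divide_distrib)
    then have y: "y \<in> convex hull (f ` T)"
      using hull_mono[of "f ` T'" "f ` T" convex] T' by auto
    have ry: "r *\<^sub>R y = (\<Sum>t\<in>T'. w t *\<^sub>R f t)"
      using r by (simp add: y_def scaleR_sum_right)
    have zy: "z = (1 - r) *\<^sub>R f s + r *\<^sub>R y" using zs ws ry by simp
    show ?thesis
    proof (cases "f s = y")
      case True
      then have "z = f s" using zy by (simp add: scaleR_left_diff_distrib)
      then show ?thesis using z by simp
    next
      case False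
      then have "z \<in> open_segment (f s) y"
        using zy r by (auto simp: in_segment)
      moreover have "f s \<in> convex hull (f ` T)" using s by (simp add: hull_inc)
      ultimately show ?thesis using F y z by (auto simp: face_of_def)
    qed
  qed
qed

text \<open>By the preceding lemma, a convex combination that lies in \<open>F\<close> gives
  positive weight only to points of \<open>F\<close>.\<close>

lemma face_eq_convex_hull:
  fixes f :: "'i \<Rightarrow> 'a::real_vector"
  assumes "finite T" and F: "F face_of convex hull (f ` T)"
  shows "F = convex hull (f ` {t\<in>T. f t \<in> F})"
proof
  show "convex hull (f ` {t\<in>T. f t \<in> F}) \<subseteq> F"
    using face_of_imp_convex[OF F] by (intro hull_minimal) auto
  show "F \<subseteq> convex hull (f ` {t\<in>T. f t \<in> F})"
  proof
    fix z assume z: "z \<in> F"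
    then have "z \<in> convex hull (f ` T)" using F face_of_imp_subset by blast
    then obtain w where w: "\<forall>t\<in>T. 0 \<le> w t" "sum w T = 1" "(\<Sum>t\<in>T. w t *\<^sub>R f t) = z"
      unfolding in_convex_hull_image_iff[OF assms(1)] by blast
    let ?Y = "{t\<in>T. f t \<in> F}"
    have out: "w t = 0" if "t \<in> T - ?Y" for t
    proof (rule ccontr)
      assume "w t \<noteq> 0"
      then have "0 < w t" using w(1) that by (simp add: less_le)
      then show False
        using face_of_contains_positive_weight[OF assms, of w t] w z that by auto
    qed
    have "sum w ?Y = sum w T"
      using assms(1) out by (intro sum.mono_neutral_left) auto
    moreover have "(\<Sum>t\<in>?Y. w t *\<^sub>R f t) = (\<Sum>t\<in>T. w t *\<^sub>R f t)"
      using assms(1) out by (intro sum.mono_neutral_left) auto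
    ultimately show "z \<in> convex hull (f ` ?Y)"
      using w assms(1) by (subst in_convex_hull_image_iff) (auto intro!: exI[of _ w])
  qed
qed

text \<open>The positive and the negative part of a dependency, normalised, represent the same
  point. The negative part puts it into \<open>F\<close>, and then every point with positive weight
  lies in \<open>F\<close>.\<close>

lemma relation_closed_face:
  fixes f :: "'i \<Rightarrow> 'a::real_vector"
  assumes "finite T" and F: "F face_of convex hull (f ` T)"
  shows "relation_closed f T {t\<in>T. f t \<in> F}"
  unfolding relation_closed_def
proof (intro allI impI ballI)
  fix c s
  assume rel: "affine_relation f T c" and neg: "\<forall>t\<in>T. c t < 0 \<longrightarrow> t \<in> {t\<in>T. f t \<in> F}"
    and s: "s \<in> T" "0 < c s"
  define p where "p t = max (c t) 0" for t
  define m where "m t = max (- c t) 0" for t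
  have c: "c t = p t - m t" for t by (simp add: p_def m_def)
  have pm: "sum p T = sum m T" "(\<Sum>t\<in>T. p t *\<^sub>R f t) = (\<Sum>t\<in>T. m t *\<^sub>R f t)"
    using rel by (auto simp: affine_relation_def c sum_subtractf scaleR_left_diff_distrib)
  define P where "P = sum p T"
  have "0 < P" unfolding P_def
    using s assms(1) by (intro sum_pos2[of _ s]) (auto simp: p_def)
  define z where "z = (\<Sum>t\<in>T. (p t / P) *\<^sub>R f t)"
  have "z = inverse P *\<^sub>R (\<Sum>t\<in>T. p t *\<^sub>R f t)"
    by (simp add: z_def scaleR_sum_right divide_inverse mult.commute)
  also have "\<dots> = (\<Sum>t\<in>T. (m t / P) *\<^sub>R f t)"
    by (simp add: pm scaleR_sum_right divide_inverse mult.commute)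
  also have "\<dots> = (\<Sum>t\<in>{t\<in>T. f t \<in> F}. (m t / P) *\<^sub>R f t)"
    using assms(1) neg by (intro sum.mono_neutral_right) (auto simp: m_def max_def)
  also have "\<dots> \<in> F"
  proof (rule convex_sum)
    have "sum m {t\<in>T. f t \<in> F} = sum m T"
      using assms(1) neg by (intro sum.mono_neutral_left) (auto simp: m_def max_def)
    then show "(\<Sum>t\<in>{t\<in>T. f t \<in> F}. m t / P) = 1"
      using pm \<open>0 < P\<close> by (simp add: P_def flip: sum_divide_distrib)
  qed (use assms(1) \<open>0 < P\<close> face_of_imp_convex[OF F] in \<open>auto simp: m_def\<close>)
  finally have "z \<in> F" .
  moreover have "(\<Sum>t\<in>T. p t / P) = 1"
    using \<open>0 < P\<close> by (simp add: P_def flip: sum_divide_distrib)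
  ultimately have "f s \<in> F"
    using face_of_contains_positive_weight[OF assms, of "\<lambda>t. p t / P" s] s \<open>0 < P\<close>
    by (auto simp: z_def p_def)
  then show "s \<in> {t\<in>T. f t \<in> F}" using s by simp
qed

text \<open>Two representations of one point differ by a dependency. If one of them uses only
  \<open>Y\<close>, negative coefficients occur only in \<open>Y\<close>, so closedness confines the
  other one to \<open>Y\<close> as well.\<close>

lemma face_relation_closed:
  fixes f :: "'i \<Rightarrow> 'a::real_vector"
  assumes "finite T" "Y \<subseteq> T" and cl: "relation_closed f T Y"
  shows "convex hull (f ` Y) face_of convex hull (f ` T)"
    and "{t\<in>T. f t \<in> convex hull (f ` Y)} = Y"
proof -
  have "finite Y" using assms finite_subset by blast
  have weights: "w t = 0"
    if w: "\<forall>t\<in>T. 0 \<le> w t" "sum w T = 1" "(\<Sum>t\<in>T. w t *\<^sub>R f t) \<in> convex hull (f ` Y)"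
      "t \<in> T - Y" for w t
  proof (rule ccontr)
    assume "w t \<noteq> 0"
    then have pos: "0 < w t" using w by (simp add: less_le)
    obtain v where v: "\<forall>t\<in>Y. 0 \<le> v t" "sum v Y = 1"
      "(\<Sum>t\<in>Y. v t *\<^sub>R f t) = (\<Sum>t\<in>T. w t *\<^sub>R f t)"
      using w(3) unfolding in_convex_hull_image_iff[OF \<open>finite Y\<close>] by blast
    define v' where "v' t = (if t \<in> Y then v t else 0)" for t
    have "sum v' T = sum v' Y" 
      using assms by (intro sum.mono_neutral_right) (auto simp: v'_def)
    also have "\<dots> = 1" using v by (simp add: v'_def)
    finally have 1: "sum v' T = 1" .
    have "(\<Sum>t\<in>T. v' t *\<^sub>R f t) = (\<Sum>t\<in>Y. v' t *\<^sub>R f t)"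
      using assms by (intro sum.mono_neutral_right) (auto simp: v'_def)
    also have "\<dots> = (\<Sum>t\<in>T. w t *\<^sub>R f t)" using v by (simp add: v'_def)
    finally have "affine_relation f T (\<lambda>t. w t - v' t)"
      using 1 w(2) by (simp add: affine_relation_def sum_subtractf scaleR_left_diff_distrib)
    moreover have "\<forall>t\<in>T. w t - v' t < 0 \<longrightarrow> t \<in> Y" "0 < w t - v' t"
      using w pos by (auto simp: v'_def)
    ultimately have "t \<in> Y" using cl w(4) unfolding relation_closed_def by blast
    then show False using w by simp
  qed
  have inY: "x \<in> convex hull (f ` Y)"
    if w: "\<forall>t\<in>T. 0 \<le> w t" "sum w T = 1" "(\<Sum>t\<in>T. w t *\<^sub>R f t) = x"
      and out: "\<forall>t\<in>T - Y. w t = 0" for w x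
  proof -
    have "sum w Y = sum w T" "(\<Sum>t\<in>Y. w t *\<^sub>R f t) = (\<Sum>t\<in>T. w t *\<^sub>R f t)"
      using assms out by (auto intro!: sum.mono_neutral_left)
    then show ?thesis using w assms(2)
      by (subst in_convex_hull_image_iff[OF \<open>finite Y\<close>]) (auto intro!: exI[of _ w])
  qed
  show "convex hull (f ` Y) face_of convex hull (f ` T)"
    unfolding face_of_def
  proof (intro conjI ballI impI)
    show "convex hull (f ` Y) \<subseteq> convex hull (f ` T)"
      using assms by (intro hull_mono) auto
    show "convex (convex hull (f ` Y))" by (rule convex_convex_hull)
    fix a b x
    assume a: "a \<in> convex hull (f ` T)" and b: "b \<in> convex hull (f ` T)"
      and x: "x \<in> convex hull (f ` Y)" "x \<in> open_segment a b"
    obtain u where u: "\<forall>t\<in>T. 0 \<le> u t" "sum u T = 1" "(\<Sum>t\<in>T. u t *\<^sub>R f t) = a"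
      using a unfolding in_convex_hull_image_iff[OF assms(1)] by blast
    obtain v where v: "\<forall>t\<in>T. 0 \<le> v t" "sum v T = 1" "(\<Sum>t\<in>T. v t *\<^sub>R f t) = b"
      using b unfolding in_convex_hull_image_iff[OF assms(1)] by blast
    obtain r where r: "0 < r" "r < 1" "x = (1 - r) *\<^sub>R a + r *\<^sub>R b"
      using x(2) by (auto simp: in_segment)
    define w where "w t = (1 - r) * u t + r * v t" for t
    have w: "\<forall>t\<in>T. 0 \<le> w t" "sum w T = 1" "(\<Sum>t\<in>T. w t *\<^sub>R f t) = x"
      using u v r
      by (auto simp: w_def sum.distrib scaleR_left_distrib scaleR_sum_right simp flip: sum_distrib_left)
    \<comment> \<open>Outside \<open>Y\<close> the mixture \<open>w\<close> of \<open>u\<close> and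
      \<open>v\<close> vanishes, hence so do both its nonnegative summands.\<close>
    have "(1 - r) * u t = 0 \<and> r * v t = 0" if "t \<in> T - Y" for t
      using weights[OF w(1,2) _ that] w(3) x(1) u(1) v(1) r that
      by (auto simp: w_def add_nonneg_eq_0_iff)
    then have "\<forall>t\<in>T - Y. u t = 0" "\<forall>t\<in>T - Y. v t = 0" using r by auto
    then show "a \<in> convex hull (f ` Y)" "b \<in> convex hull (f ` Y)"
      using inY[OF u] inY[OF v] by auto
  qed
  show "{t\<in>T. f t \<in> convex hull (f ` Y)} = Y"
  proof (intro equalityI subsetI)
    fix s assume "s \<in> {t\<in>T. f t \<in> convex hull (f ` Y)}"
    then have s: "s \<in> T" "f s \<in> convex hull (f ` Y)" by auto
    \<comment> \<open>The point mass at \<open>s\<close> represents \<open>f s\<close>; if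
      \<open>s\<close> were outside \<open>Y\<close>, \<open>weights\<close> would make this mass
      zero.\<close>
    have "(\<Sum>t\<in>T. (if t = s then 1 else 0) *\<^sub>R f t) = (\<Sum>t\<in>T. if t = s then f t else 0)"
      by (intro sum.cong) auto
    also have "\<dots> = f s" using s assms(1) by simp
    finally have 1: "(\<Sum>t\<in>T. (if t = s then 1 else 0) *\<^sub>R f t) = f s" .
    show "s \<in> Y"
    proof (rule ccontr)
      assume "s \<notin> Y"
      then have "(if s = s then 1 else 0 :: real) = 0"
        using s 1 assms(1) by (intro weights) (auto simp del: if_P)
      then show False by simp
    qed
  qed (use assms in \<open>auto intro: hull_inc\<close>)
qed

lemma bij_betw_faces_relation_closed:
  fixes f :: "'i \<Rightarrow> 'a::real_vector"
  assumes "finite T"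
  shows "bij_betw (\<lambda>F. {t\<in>T. f t \<in> F}) {F. F face_of convex hull (f ` T)}
    {Y. Y \<subseteq> T \<and> relation_closed f T Y}"
  using face_eq_convex_hull[OF assms, of _ f] relation_closed_face[OF assms, of _ f]
    face_relation_closed[OF assms, of _ f]
  by (intro bij_betw_byWitness[where f' = "\<lambda>Y. convex hull (f ` Y)"]) auto

text \<open>The isomorphism goes through the closed parameter sets: from a face to its parameters,
  then to the hull of their images under \<open>g\<close>.\<close>

lemma combinatorially_equivalentI:
  fixes f :: "'i \<Rightarrow> 'a::real_vector" and g :: "'i \<Rightarrow> 'b::real_vector"
  assumes "finite T" and "\<And>Y. Y \<subseteq> T \<Longrightarrow> relation_closed f T Y \<longleftrightarrow> relation_closed g T Y"
  shows "combinatorially_equivalent (convex hull (f ` T)) (convex hull (g ` T))"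
proof -
  let ?L = "\<lambda>F. {t\<in>T. f t \<in> F}" and ?R = "\<lambda>Y. convex hull (g ` Y)"
  let ?C = "{Y. Y \<subseteq> T \<and> relation_closed g T Y}"
  have C: "{Y. Y \<subseteq> T \<and> relation_closed f T Y} = ?C" using assms(2) by auto
  note L = bij_betw_faces_relation_closed[OF assms(1), of f, unfolded C]
  have R: "bij_betw ?R ?C {G. G face_of convex hull (g ` T)}"
    using face_eq_convex_hull[OF assms(1), of _ g] relation_closed_face[OF assms(1), of _ g]
      face_relation_closed[OF assms(1), of _ g]
    by (intro bij_betw_byWitness[where f' = "\<lambda>F. {t\<in>T. g t \<in> F}"]) auto
  have "F \<subseteq> F' \<longleftrightarrow> ?R (?L F) \<subseteq> ?R (?L F')"
    if F: "F face_of convex hull (f ` T)" and F': "F' face_of convex hull (f ` T)" for F F'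
  proof
    assume "F \<subseteq> F'"
    then show "?R (?L F) \<subseteq> ?R (?L F')" by (intro hull_mono) auto
  next
    assume sub: "?R (?L F) \<subseteq> ?R (?L F')"
    have "?L F \<in> ?C" "?L F' \<in> ?C" using L F F' by (auto simp: bij_betw_def)
    then have "{t\<in>T. g t \<in> ?R (?L F)} = ?L F" "{t\<in>T. g t \<in> ?R (?L F')} = ?L F'"
      using face_relation_closed(2)[OF assms(1), of "?L F" g]
        face_relation_closed(2)[OF assms(1), of "?L F'" g] by auto
    with sub have "?L F \<subseteq> ?L F'" by blast
    then have "convex hull (f ` ?L F) \<subseteq> convex hull (f ` ?L F')" by (intro hull_mono) auto
    then show "F \<subseteq> F'"
      using face_eq_convex_hull[OF assms(1) F] face_eq_convex_hull[OF assms(1) F'] by simp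
  qed
  moreover have "bij_betw (?R \<circ> ?L) {F. F face_of convex hull (f ` T)} {G. G face_of convex hull (g ` T)}"
    using L R by (rule bij_betw_trans)
  ultimately show ?thesis
    unfolding combinatorially_equivalent_def by (intro exI[of _ "?R \<circ> ?L"]) simp
qed

section \<open>Chebyshev curves\<close>

lemma sum_fun_apply: "(\<Sum>t\<in>A. F t) i = (\<Sum>t\<in>A. F t i)"
  by (induction A rule: infinite_finite_induct) simp_all

text \<open>Serves to carry a sign statement along \<open>A\<close>. The step is an equivalence, so
  \<open>t\<close> may lie on either side of \<open>s\<close>; the induction is on the number of
  points of \<open>A\<close> in between.\<close>

lemma neighbour_induct:
  fixes A :: "'a::linorder set"
  assumes "finite A" and "s \<in> A" "t \<in> A" "P s"
    and step: "\<And>s t. s \<in> A \<Longrightarrow> t \<in> A \<Longrightarrow> s < t \<Longrightarrow> A \<inter> {s<..<t} = {} \<Longrightarrow> P s \<longleftrightarrow> P t"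
  shows "P t"
proof -
  have eq: "P s \<longleftrightarrow> P t" if "s \<in> A" "t \<in> A" "s < t" for s t
    using that
  proof (induction "card (A \<inter> {s<..<t})" arbitrary: s t rule: less_induct)
    case less
    show ?case
    proof (cases "A \<inter> {s<..<t} = {}")
      case True
      then show ?thesis by (rule step[OF less.prems])
    next
      case False
      then obtain u where u: "u \<in> A" "s < u" "u < t" by auto
      have "A \<inter> {s<..<u} \<subset> A \<inter> {s<..<t}" "A \<inter> {u<..<t} \<subset> A \<inter> {s<..<t}"
        using u by auto
      then have "card (A \<inter> {s<..<u}) < card (A \<inter> {s<..<t})" "card (A \<inter> {u<..<t}) < card (A \<inter> {s<..<t})"
        using assms(1) by (simp_all add: psubset_card_mono)
      then have "P s \<longleftrightarrow> P u" "P u \<longleftrightarrow> P t"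
        using less.hyps[OF _ less.prems(1) u(1,2)] less.hyps[OF _ u(1) less.prems(2) u(3)] by simp_all
      then show ?thesis by simp
    qed
  qed
  show ?thesis
  proof (cases "s = t")
    case False
    then have "P s \<longleftrightarrow> P t"
      using eq[OF assms(2,3)] eq[OF assms(3,2)] by (meson neqE)
    then show ?thesis using assms(4) by simp
  qed (use assms(4) in simp)
qed

text \<open>\<open>haar\<close> says that 1 and the coordinate functions form a Chebyshev system: no
  hyperplane contains \<open>D + 1\<close> points of the curve. That \<open>I\<close> is an interval
  serves the intermediate value theorem, that it is infinite supplies auxiliary points, and
  \<open>beyond\<close> reduces vector equations to \<open>D\<close> coordinates.\<close>

locale chebyshev_curve =
  fixes I :: "real set" and D :: nat and f :: "real \<Rightarrow> nat \<Rightarrow> real"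
  assumes interval: "is_interval I" "infinite I"
    and continuous: "continuous_on I (\<lambda>t. f t i)"
    and beyond: "D \<le> i \<Longrightarrow> f t i = 0"
    and haar: "Z \<subseteq> I \<Longrightarrow> finite Z \<Longrightarrow> card Z = D + 1 \<Longrightarrow>
      (\<And>t. t \<in> Z \<Longrightarrow> w0 + (\<Sum>i<D. w i * f t i) = 0) \<Longrightarrow> w0 = 0 \<and> (\<forall>i<D. w i = 0)"
begin

text \<open>An affine function that vanishes at most points of \<open>A\<close> isolates one or two
  coefficients of \<open>c\<close> in this identity.\<close>

lemma relation_pairing:
  assumes "affine_relation f A c"
  shows "(\<Sum>t\<in>A. c t * (w0 + (\<Sum>i<D. w i * f t i))) = 0"
proof -
  have 0: "(\<Sum>t\<in>A. c t * f t i) = 0" for i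
    using assms by (auto simp: affine_relation_def fun_eq_iff sum_fun_apply)
  have "(\<Sum>t\<in>A. c t * (w0 + (\<Sum>i<D. w i * f t i))) =
      (\<Sum>t\<in>A. c t) * w0 + (\<Sum>t\<in>A. \<Sum>i<D. w i * (c t * f t i))"
    by (simp add: distrib_left sum.distrib sum_distrib_left sum_distrib_right mult.left_commute)
  also have "(\<Sum>t\<in>A. \<Sum>i<D. w i * (c t * f t i)) = (\<Sum>i<D. w i * (\<Sum>t\<in>A. c t * f t i))"
    by (subst sum.swap) (simp add: sum_distrib_left)
  finally show ?thesis using 0 assms by (simp add: affine_relation_def)
qed

text \<open>There are \<open>D\<close> homogeneous equations for \<open>D + 1\<close> coefficients;
  a further zero would contradict \<open>haar\<close>.\<close>

lemma vanishing_hyperplane: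
  assumes "finite Z" "Z \<subseteq> I" "card Z = D"
  obtains w0 w where "\<And>t. t \<in> Z \<Longrightarrow> w0 + (\<Sum>i<D. w i * f t i) = 0"
    "\<And>t. t \<in> I - Z \<Longrightarrow> w0 + (\<Sum>i<D. w i * f t i) \<noteq> 0"
proof -
  define M where "M i t = (case i of 0 \<Rightarrow> 1 | Suc j \<Rightarrow> f t j)" for i t
  have "card Z < card {..<Suc D}" using assms by simp
  from underdetermined_system[OF assms(1) _ this, of M] obtain c
    where c: "\<And>t. t \<in> Z \<Longrightarrow> (\<Sum>i<Suc D. c i * M i t) = 0" and nz: "\<exists>i<Suc D. c i \<noteq> 0"
    by auto
  have eq: "(\<Sum>i<Suc D. c i * M i t) = c 0 + (\<Sum>i<D. c (Suc i) * f t i)" for t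
    by (simp only: sum.lessThan_Suc_shift) (simp add: M_def)
  show ?thesis
  proof (rule that[of "c 0" "\<lambda>i. c (Suc i)"])
    show "c 0 + (\<Sum>i<D. c (Suc i) * f t i) = 0" if "t \<in> Z" for t
      using c[OF that] eq by simp
    show "c 0 + (\<Sum>i<D. c (Suc i) * f t i) \<noteq> 0" if "t \<in> I - Z" for t
    proof
      assume 0: "c 0 + (\<Sum>i<D. c (Suc i) * f t i) = 0"
      have "c 0 = 0 \<and> (\<forall>i<D. c (Suc i) = 0)"
        using that assms 0 c eq by (intro haar[of "insert t Z"]) auto
      then show False using nz by (metis not0_implies_Suc Suc_less_eq)
    qed
  qed
qed

section \<open>Supports and signs of circuits\<close>

text \<open>A hyperplane through the points of \<open>A\<close> other than \<open>x\<close>, but not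
  through \<open>x\<close>, reduces the pairing to a nonzero multiple of \<open>c x\<close>.\<close>

lemma relation_support:
  assumes "finite A" "A \<subseteq> I" "card A \<le> D + 1" "affine_relation f A c" "x \<in> A"
  shows "c x = 0"
proof -
  have fin: "finite (A - {x})" and le: "card (A - {x}) \<le> D" using assms by auto
  \<comment> \<open>Points of \<open>I\<close> outside \<open>A\<close> pad the zero set to exactly
    \<open>D\<close> elements.\<close>
  have "infinite (I - A)" using interval(2) assms(1) by simp
  then obtain E where E: "finite E" "card E = D - card (A - {x})" "E \<subseteq> I - A"
    by (metis infinite_arbitrarily_large)
  have "card (A - {x} \<union> E) = D"
    using E fin le by (subst card_Un_disjoint) auto
  then obtain w0 w where w: "\<And>t. t \<in> A - {x} \<union> E \<Longrightarrow> w0 + (\<Sum>i<D. w i * f t i) = 0"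
    "\<And>t. t \<in> I - (A - {x} \<union> E) \<Longrightarrow> w0 + (\<Sum>i<D. w i * f t i) \<noteq> 0"
    using vanishing_hyperplane[of "A - {x} \<union> E"] E assms(1,2) by blast
  have "0 = (\<Sum>t\<in>A. c t * (w0 + (\<Sum>i<D. w i * f t i)))"
    using relation_pairing[OF assms(4)] by simp
  also have "\<dots> = c x * (w0 + (\<Sum>i<D. w i * f x i))"
    using assms(1,5) w(1) by (subst sum.remove[of _ x]) auto
  finally show ?thesis using w(2)[of x] assms(2,5) E by auto
qed

text \<open>The conditions are \<open>D + 1\<close> homogeneous equations, one for the coefficient
  sum and one per coordinate below \<open>D\<close>; the other coordinates vanish.\<close>

lemma relation_exists:
  assumes "finite A" "D + 2 \<le> card A"
  obtains c where "affine_relation f A c" "\<exists>x\<in>A. c x \<noteq> 0"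
proof -
  define M where "M t i = (case i of 0 \<Rightarrow> 1 | Suc j \<Rightarrow> f t j)" for i t
  have "card {..<Suc D} < card A" using assms by simp
  from underdetermined_system[OF _ assms(1) this, of M] obtain c
    where c: "\<And>i. i < Suc D \<Longrightarrow> (\<Sum>t\<in>A. c t * M t i) = 0" and nz: "\<exists>t\<in>A. c t \<noteq> 0"
    by auto
  have "(\<Sum>t\<in>A. c t * f t i) = 0" for i
    using c[of "Suc i"] beyond[of i] by (cases "i < D") (auto simp: M_def)
  then have "affine_relation f A c"
    using c[of 0] by (auto simp: affine_relation_def fun_eq_iff sum_fun_apply M_def)
  then show ?thesis using that nz by blast
qed

text \<open>A zero coefficient would leave a nontrivial dependency on only \<open>D + 1\<close>
  points.\<close>

lemma circuit_nonzero:
  assumes A: "finite A" "A \<subseteq> I" "card A = D + 2"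
    and c: "affine_relation f A c" "\<exists>x\<in>A. c x \<noteq> 0" and t: "t \<in> A"
  shows "c t \<noteq> 0"
proof
  assume 0: "c t = 0"
  then have "affine_relation f (A - {t}) c"
    using A c(1) by (intro affine_relation_restrict[OF c(1)]) auto
  then have "c x = 0" if "x \<in> A - {t}" for x
    using relation_support[of "A - {t}" c x] A t that by auto
  then show False using c(2) 0 by auto
qed

text \<open>A combination vanishing at the other \<open>D\<close> points has no further zero, so by the
  intermediate value theorem it has the same sign at the two neighbours.\<close>

lemma circuit_alternates:
  assumes A: "finite A" "A \<subseteq> I" "card A = D + 2"
    and c: "affine_relation f A c" "\<exists>x\<in>A. c x \<noteq> 0"
    and st: "s \<in> A" "t \<in> A" "s < t" "A \<inter> {s<..<t} = {}"
  shows "c s * c t < 0"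
proof -
  have "card (A - {s, t}) = D" using A st by (subst card_Diff_subset) auto
  then obtain w0 w where
    w1: "\<And>u. u \<in> A - {s,t} \<Longrightarrow> w0 + (\<Sum>i<D. w i * f u i) = 0"
    and w2: "\<And>u. u \<in> I - (A - {s,t}) \<Longrightarrow> w0 + (\<Sum>i<D. w i * f u i) \<noteq> 0"
    using vanishing_hyperplane[of "A - {s,t}"] A by blast
  define h where "h u = w0 + (\<Sum>i<D. w i * f u i)" for u
  have zero: "h u = 0" if "u \<in> A - {s,t}" for u
    using w1 that by (simp add: h_def)
  have nz: "h u \<noteq> 0" if "u \<in> I - (A - {s,t})" for u
    using w2 that by (simp add: h_def)
  have sub: "{s..t} \<subseteq> I"
    using interval(1) A(2) st by (meson atLeastAtMost_iff mem_is_interval_1_I subsetD subsetI)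
  have "continuous_on I h"
    unfolding h_def by (intro continuous_intros continuous)
  then have cont: "continuous_on {s..t} h" using sub continuous_on_subset by blast
  have nz': "h u \<noteq> 0" if "u \<in> {s..t}" for u
  proof -
    have "u \<in> I" using that sub by blast
    moreover have "u \<notin> A - {s,t}" using that st(4) by (force simp: disjoint_iff)
    ultimately show ?thesis using nz by blast
  qed
  have pos: "0 < h s * h t"
  proof (rule ccontr)
    assume "\<not> ?thesis"
    then have "h s \<le> 0 \<and> 0 \<le> h t \<or> h t \<le> 0 \<and> 0 \<le> h s"
      by (auto simp: not_less mult_le_0_iff)
    then have "\<exists>u\<ge>s. u \<le> t \<and> h u = 0"
      using IVT'[OF _ _ less_imp_le[OF st(3)] cont, of 0]
        IVT2'[OF _ _ less_imp_le[OF st(3)] cont, of 0] by blast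
    then obtain u where "u \<in> {s..t}" "h u = 0" by auto
    then show False using nz' by blast
  qed
  \<comment> \<open>The pairing with \<open>h\<close> leaves only the terms at \<open>s\<close> and
    \<open>t\<close>; as \<open>h\<close> has the same sign at both, the coefficients have opposite
    signs.\<close>
  have "0 = (\<Sum>u\<in>A. c u * h u)"
    using relation_pairing[OF c(1)] by (simp add: h_def)
  also have "\<dots> = (\<Sum>u\<in>{s,t}. c u * h u)"
    using A st zero by (intro sum.mono_neutral_right) auto
  also have "\<dots> = c s * h s + c t * h t" using st by simp
  finally have "c s * h s = - (c t * h t)" by simp
  moreover have "c t * h t \<noteq> 0"
    using circuit_nonzero[OF A c st(2)] nz'[of t] st by simp
  ultimately have "(c s * h s) * (c t * h t) < 0"
    by (metis mult_minus_left neg_less_0_iff_less not_real_square_gt_zero)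
  then have "(c s * c t) * (h s * h t) < 0" by (simp add: mult_ac)
  then show ?thesis using pos by (simp add: mult_less_0_iff[of "c s * c t"])
qed

text \<open>A point is removed from the support by subtracting a multiple of a dependency that avoids \<open>x\<close>;
  the minimal ratio keeps nonnegative coefficients nonnegative.\<close>

lemma conformal_circuit:
  assumes "finite T" "T \<subseteq> I" "affine_relation f T c" "x \<in> T" "0 < c x"
  obtains A e where "A \<subseteq> T" "card A = D + 2" "x \<in> A" "affine_relation f A e" "0 < e x"
    "\<And>t. t \<in> A \<Longrightarrow> e t < 0 \<Longrightarrow> c t < 0"
  using assms
proof (induction "card T" arbitrary: T c thesis rule: less_induct)
  case less
  note T = less.prems(2,3) and c = less.prems(4) and x = less.prems(5,6)
  consider "card T \<le> D + 1" | "card T = D + 2" | "D + 3 \<le> card T" by linarith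
  then show ?case
  proof cases
    case 1
    then show ?thesis using relation_support[OF T(1,2) _ c x(1)] x(2) by simp
  next
    case 2
    then show ?thesis using less.prems(1)[of T c] c x by auto
  next
    case 3
    \<comment> \<open>A dependency that vanishes at \<open>y\<close> lives on
      \<open>T - {y}\<close>, where the induction hypothesis applies; the conditions on negative
      signs compose.\<close>
    have reduce: thesis if y: "y \<in> T" "y \<noteq> x" "e y = 0" and e: "affine_relation f T e" "0 < e x"
      "\<And>t. t \<in> T \<Longrightarrow> e t < 0 \<Longrightarrow> c t < 0" for y e
    proof -
      have "card (T - {y}) < card T" using y T by (meson card_Diff1_less)
      moreover have "affine_relation f (T - {y}) e"
        using y T by (intro affine_relation_restrict[OF e(1)]) auto
      ultimately obtain A e' where "A \<subseteq> T - {y}" "card A = D + 2" "x \<in> A" "affine_relation f A e'"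
          "0 < e' x" "\<And>t. t \<in> A \<Longrightarrow> e' t < 0 \<Longrightarrow> e t < 0"
        using less.hyps[of "T - {y}" e] T x y e by blast
      then show thesis using less.prems(1)[of A e'] e(3) by blast
    qed
    have "D + 2 \<le> card (T - {x})" using 3 x T by simp
    then obtain e where e: "affine_relation f (T - {x}) e" "\<exists>y\<in>T - {x}. e y \<noteq> 0"
      using relation_exists[of "T - {x}"] T by auto
    \<comment> \<open>\<open>e\<close> is arbitrary at \<open>x\<close>; the value 0 there makes it
      a dependency on \<open>T\<close> and lets the subtraction leave \<open>c x\<close>
      unchanged.\<close>
    define e' where "e' = e(x := 0)"
    have "affine_relation f (T - {x}) e'"
      using e(1) by (simp add: affine_relation_def e'_def)
    then have e': "affine_relation f T e'" "e' x = 0" "\<exists>y\<in>T - {x}. e' y \<noteq> 0"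
      using T e(2) by (auto intro: affine_relation_extend simp: e'_def)
    show ?thesis
    proof (cases "\<exists>y\<in>T. 0 \<le> c y \<and> e' y \<noteq> 0")
      case True
      then obtain y0 where y0: "y0 \<in> T" "0 \<le> c y0" "e' y0 \<noteq> 0" by blast
      \<comment> \<open>The sign makes \<open>u\<close> positive at \<open>y0\<close>, so the set
        \<open>P\<close> of candidates for removal is nonempty.\<close>
      define u where "u = (\<lambda>t. sgn (e' y0) * e' t)"
      have u: "affine_relation f T u" "u x = 0" "0 < u y0"
        using e' y0 by (auto simp: u_def affine_relation_scale sgn_if)
      define P where "P = {y\<in>T. 0 \<le> c y \<and> 0 < u y}"
      have P: "finite P" "P \<noteq> {}" using T y0 u by (auto simp: P_def)
      define r where "r = Min ((\<lambda>y. c y / u y) ` P)"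
      have "r \<in> (\<lambda>y. c y / u y) ` P" unfolding r_def using P by (intro Min_in) auto
      then obtain y where y: "y \<in> P" "r = c y / u y" by blast
      have r: "r \<le> c t / u t" if "t \<in> P" for t
        unfolding r_def using P that by (intro Min_le) auto
      have r0: "0 \<le> r" using y by (auto simp: P_def)
      show ?thesis
      proof (rule reduce[of y "\<lambda>t. c t - r * u t"])
        show "affine_relation f T (\<lambda>t. c t - r * u t)"
          using c u(1) by (intro affine_relation_diff affine_relation_scale)
        show "c t < 0" if "t \<in> T" "c t - r * u t < 0" for t
        proof (rule ccontr)
          assume nn: "\<not> c t < 0"
          show False
          proof (cases "0 < u t")
            case True
            then show False using r[of t] nn that by (simp add: P_def field_simps)
          next
            case False
            then have "r * u t \<le> 0" using r0 by (simp add: mult_nonneg_nonpos)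
            then show False using nn that by linarith
          qed
        qed
      qed (use y u x in \<open>auto simp: P_def\<close>)
    next
      case False
      \<comment> \<open>Here \<open>e'\<close> is nonzero only where \<open>c\<close> is negative,
        so any multiple of it may be subtracted; the factor is the one that clears
        \<open>y\<close>.\<close>
      obtain y where y: "y \<in> T" "y \<noteq> x" "e' y \<noteq> 0" using e'(3) by auto
      show ?thesis
      proof (rule reduce[of y "\<lambda>t. c t - c y / e' y * e' t"])
        show "affine_relation f T (\<lambda>t. c t - c y / e' y * e' t)"
          using c e'(1) by (intro affine_relation_diff affine_relation_scale)
        show "c t < 0" if "t \<in> T" "c t - c y / e' y * e' t < 0" for t
        proof (cases "e' t = 0")
          case True
          then show ?thesis using that by simp
        next
          case nonzero: False
          then show ?thesis using False that(1) by (meson not_le)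
        qed
      qed (use y e' x in auto)
    qed
  qed
qed

end

section \<open>Comparison of two Chebyshev curves\<close>

text \<open>A dependency of \<open>g\<close> is reduced to a circuit on some \<open>A\<close>. The
  circuit of \<open>f\<close> on the same \<open>A\<close>, oriented to be positive at
  \<open>x\<close>, has the same signs by alternation, so closedness for \<open>f\<close> applies to
  it.\<close>

lemma relation_closed_transfer:
  assumes f: "chebyshev_curve I D f" and g: "chebyshev_curve I D g"
    and T: "finite T" "T \<subseteq> I" and cl: "relation_closed f T Y"
  shows "relation_closed g T Y"
  unfolding relation_closed_def
proof (intro allI impI ballI)
  interpret f: chebyshev_curve I D f by (rule f)
  interpret g: chebyshev_curve I D g by (rule g)
  fix c x
  assume c: "affine_relation g T c" and neg: "\<forall>t\<in>T. c t < 0 \<longrightarrow> t \<in> Y"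
    and x: "x \<in> T" "0 < c x"
  obtain A e where A: "A \<subseteq> T" "card A = D + 2" "x \<in> A" and e: "affine_relation g A e" "0 < e x"
    and sub: "\<And>t. t \<in> A \<Longrightarrow> e t < 0 \<Longrightarrow> c t < 0"
    using g.conformal_circuit[OF T c x] by blast
  have A': "finite A" "A \<subseteq> I" using A T finite_subset by auto
  obtain b0 where b0: "affine_relation f A b0" "\<exists>x\<in>A. b0 x \<noteq> 0"
    using f.relation_exists[of A] A A' by auto
  have bx: "b0 x \<noteq> 0" using f.circuit_nonzero[OF A' A(2) b0 A(3)] .
  define b where "b = (\<lambda>t. sgn (b0 x) * b0 t)"
  have b: "affine_relation f A b" "0 < b x"
    using b0 bx by (auto simp: b_def affine_relation_scale sgn_if)
  have same: "0 < b t * e t" if "t \<in> A" for t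
  proof (rule neighbour_induct[OF A'(1) A(3) that, of "\<lambda>t. 0 < b t * e t"])
    show "0 < b x * e x" using b e by simp
    fix s t assume st: "s \<in> A" "t \<in> A" "s < t" "A \<inter> {s<..<t} = {}"
    \<comment> \<open>Between neighbours both circuits change sign, so their product keeps its
      sign.\<close>
    have "b s * b t < 0" "e s * e t < 0"
      using f.circuit_alternates[OF A' A(2) b(1) _ st] g.circuit_alternates[OF A' A(2) e(1) _ st]
        b(2) e(2) A(3) by force+
    then show "0 < b s * e s \<longleftrightarrow> 0 < b t * e t"
      by (auto simp: mult_less_0_iff zero_less_mult_iff)
  qed
  define b' where "b' t = (if t \<in> A then b t else 0)" for t
  have "affine_relation f A b'" using b(1) by (simp add: affine_relation_def b'_def)
  then have "affine_relation f T b'"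
    by (rule affine_relation_extend) (use A T in \<open>auto simp: b'_def\<close>)
  moreover have "t \<in> Y" if "t \<in> T" "b' t < 0" for t
  proof -
    have t: "t \<in> A" "b t < 0" using that by (auto simp: b'_def split: if_splits)
    then have "e t < 0" using same[of t] by (simp add: zero_less_mult_iff)
    then show ?thesis using sub t(1) neg that(1) by blast
  qed
  moreover have "0 < b' x" using b A by (simp add: b'_def)
  ultimately show "x \<in> Y" using cl x(1) unfolding relation_closed_def by blast
qed

section \<open>The mixed moment curve is a Chebyshev curve\<close>

text \<open>Points are added in increasing order, and each one after the first contributes a zero of
  \<open>h'\<close> between the previous maximum and itself. The strict bounds keep these zeros
  distinct and inside any interval that contains \<open>Z\<close>.\<close>

lemma Rolle_card:
  fixes h h' :: "real \<Rightarrow> real"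
  assumes "finite Z" "Z \<noteq> {}" "\<And>z. z \<in> Z \<Longrightarrow> h z = 0"
    and der: "\<And>x. (h has_real_derivative h' x) (at x)"
  shows "\<exists>Z'. finite Z' \<and> card Z = Suc (card Z') \<and>
    (\<forall>z\<in>Z'. h' z = 0 \<and> Min Z < z \<and> z < Max Z)"
  using assms(1-3)
proof (induction Z rule: finite_linorder_max_induct)
  case (insert b A)
  show ?case
  proof (cases "A = {}")
    case False
    then obtain Z' where Z': "finite Z'" "card A = Suc (card Z')"
      "\<forall>z\<in>Z'. h' z = 0 \<and> Min A < z \<and> z < Max A"
      using insert by auto
    have mx: "Max A \<in> A" "Max A < b" "Min A \<le> Max A" using insert False by auto
    have "h (Max A) = h b" using insert.prems mx by auto
    then obtain z where z: "Max A < z" "z < b" "h' z = 0"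
    proof -
      have "continuous_on {Max A..b} h"
        using der by (meson DERIV_continuous_on has_field_derivative_at_within)
      moreover have "h differentiable (at x)" for x
        using der real_differentiable_def by blast
      ultimately obtain z where "Max A < z" "z < b" "(h has_real_derivative 0) (at z)"
        using Rolle[OF mx(2) \<open>h (Max A) = h b\<close>] by blast
      then show thesis using that DERIV_unique[OF der] by blast
    qed
    have le: "Min A \<le> b" "Max A \<le> b" using mx(2,3) by linarith+
    have "Min (insert b A) = Min A" "Max (insert b A) = b"
      unfolding Min_insert[OF insert.hyps(1) False] Max_insert[OF insert.hyps(1) False]
      using min_absorb2[OF le(1)] max_absorb1[OF le(2)] by blast+
    then have "\<forall>y\<in>insert z Z'. h' y = 0 \<and> Min (insert b A) < y \<and> y < Max (insert b A)"
      using Z' z mx by force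
    moreover have "z \<notin> Z'" using Z' z by force
    then have "card (insert b A) = Suc (card (insert z Z'))"
      using insert.hyps Z' by auto
    ultimately show ?thesis using Z'(1) by (intro exI[of _ "insert z Z'"]) auto
  qed (auto intro: exI[of _ "{}"])
qed simp

text \<open>Multiplying by \<open>e\<^bsup>ikt\<^esup>\<close> turns the trigonometric polynomial into a polynomial of degree
  at most \<open>2k\<close> in \<open>e\<^bsup>it\<^esup>\<close>.\<close>

lemma trig_poly_zeros:
  fixes a b :: "nat \<Rightarrow> real"
  assumes Z: "finite Z" "Z \<subseteq> {0<..<2 * pi}" "2 * k + 1 \<le> card Z"
    and zero: "\<And>t. t \<in> Z \<Longrightarrow> c + (\<Sum>j=1..k. a j * cos (real j * t) + b j * sin (real j * t)) = 0"
  shows "c = 0 \<and> (\<forall>j\<in>{1..k}. a j = 0 \<and> b j = 0)"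
proof -
  \<comment> \<open>By Euler's formula, the cosine and sine terms of frequency \<open>j\<close>
    combine to coefficient \<open>(a j - i b j) / 2\<close> at frequency \<open>j\<close> and its
    conjugate at \<open>-j\<close>; the shift by \<open>k\<close> makes all exponents
    nonnegative.\<close>
  define P :: "complex poly" where "P = monom (of_real c) k +
    (\<Sum>j=1..k. monom (Complex (a j) (- b j) / 2) (k + j) + monom (Complex (a j) (b j) / 2) (k - j))"
  have root: "poly P (cis t) = 0" if "t \<in> Z" for t
  proof -
    have summand: "Complex (a j) (- b j) / 2 * cis t ^ (k + j) + Complex (a j) (b j) / 2 * cis t ^ (k - j)
       = cis t ^ k * of_real (a j * cos (real j * t) + b j * sin (real j * t))" if "j \<in> {1..k}" for j
    proof -
      have *: "Complex (a j) (- b j) / 2 * cis (real j * t) + Complex (a j) (b j) / 2 * cis (- (real j * t))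
        = of_real (a j * cos (real j * t) + b j * sin (real j * t))"
        by (simp add: complex_eq_iff field_simps)
      have "cis t ^ (k + j) = cis t ^ k * cis (real j * t)"
        by (simp only: power_add Complex.DeMoivre)
      moreover have "cis t ^ (k - j) = cis t ^ k * cis (- (real j * t))"
        using that by (simp only: Complex.DeMoivre cis_mult) (simp add: of_nat_diff algebra_simps)
      ultimately show ?thesis unfolding *[symmetric] by (simp add: algebra_simps)
    qed
    have "poly P (cis t) = of_real c * cis t ^ k + (\<Sum>j=1..k.
        Complex (a j) (- b j) / 2 * cis t ^ (k + j) + Complex (a j) (b j) / 2 * cis t ^ (k - j))"
      by (simp only: P_def poly_add poly_sum poly_monom)
    also have "\<dots> = of_real c * cis t ^ k + (\<Sum>j=1..k.
        cis t ^ k * of_real (a j * cos (real j * t) + b j * sin (real j * t)))"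
      by (intro arg_cong2[where f = "(+)"] sum.cong refl summand)
    also have "\<dots> = cis t ^ k *
        of_real (c + (\<Sum>j=1..k. a j * cos (real j * t) + b j * sin (real j * t)))"
      by (simp only: of_real_add of_real_sum sum_distrib_left distrib_left mult.commute[of "of_real c"])
    finally have "poly P (cis t) = cis t ^ k *
        of_real (c + (\<Sum>j=1..k. a j * cos (real j * t) + b j * sin (real j * t)))" .
    then show ?thesis by (simp only: zero[OF that] of_real_0 mult_zero_right)
  qed
  \<comment> \<open>Parameters in \<open>Z\<close> differ by less than \<open>2 * pi\<close>, so
    distinct zeros give distinct roots of \<open>P\<close> on the unit circle.\<close>
  have inj: "inj_on cis Z"
  proof (rule inj_onI)
    fix s t assume st: "s \<in> Z" "t \<in> Z" "cis s = cis t"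
    then have "s \<in> {0<..<2 * pi}" "t \<in> {0<..<2 * pi}" using Z(2) by blast+
    then have "\<bar>s - t\<bar> < 2 * pi" by (simp add: abs_less_iff)
    then have "\<bar>Im (\<i> * complex_of_real s) - Im (\<i> * complex_of_real t)\<bar> < 2 * pi" by simp
    then have "\<i> * complex_of_real s = \<i> * complex_of_real t"
      by (rule exp_complex_eqI[OF _ st(3)[unfolded cis_conv_exp]])
    then show "s = t" by simp
  qed
  have "degree P \<le> 2 * k" unfolding P_def
    by (intro degree_add_le degree_sum_le order.trans[OF degree_monom_le]) auto
  then have "P = 0"
    using root Z(3) by (intro poly_eqI_degree[of "cis ` Z"]) (auto simp: card_image[OF inj])
  \<comment> \<open>The coefficients from \<open>k\<close> upwards already determine
    \<open>c\<close>, \<open>a\<close> and \<open>b\<close>, as the exponents \<open>k - j\<close>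
    lie below \<open>k\<close>.\<close>
  have coeff: "coeff P (k + i) = (if i = 0 then of_real c else Complex (a i) (- b i) / 2)"
    if "i \<le> k" for i
  proof -
    have "coeff P (k + i) = (if i = 0 then of_real c else 0) +
        (\<Sum>j=1..k. if j = i then Complex (a i) (- b i) / 2 else 0)"
      unfolding P_def coeff_add coeff_sum
      by (intro arg_cong2[where f = "(+)"] sum.cong refl) auto
    then show ?thesis using that by (cases "i = 0") auto
  qed
  have "c = 0" using coeff[of 0] \<open>P = 0\<close> by simp
  moreover have "a j = 0 \<and> b j = 0" if "j \<in> {1..k}" for j
    using coeff[of j] \<open>P = 0\<close> that by (auto simp: complex_eq_iff)
  ultimately show ?thesis by blast
qed

text \<open>The derivative has the same shape with \<open>d\<close> lowered by one, and by Rolle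
  only one zero is lost; the case \<open>d = 0\<close> is purely trigonometric.\<close>

lemma mixed_poly_zeros:
  fixes a b :: "nat \<Rightarrow> real"
  assumes "degree p \<le> d" "finite Z" "Z \<subseteq> {0<..<2 * pi}" "d + 2 * k + 1 \<le> card Z"
    and "\<And>t. t \<in> Z \<Longrightarrow> poly p t + (\<Sum>j=1..k. a j * cos (real j * t) + b j * sin (real j * t)) = 0"
  shows "p = 0 \<and> (\<forall>j\<in>{1..k}. a j = 0 \<and> b j = 0)"
  using assms
proof (induction d arbitrary: p a b Z)
  case 0
  then have "degree p = 0" by simp
  then obtain c where p: "p = [:c:]" by (rule degree_eq_zeroE)
  have "c = 0 \<and> (\<forall>j\<in>{1..k}. a j = 0 \<and> b j = 0)"
  proof (rule trig_poly_zeros[of Z k])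
    show "2 * k + 1 \<le> card Z" using "0.prems"(4) by simp
    show "c + (\<Sum>j=1..k. a j * cos (real j * t) + b j * sin (real j * t)) = 0" if "t \<in> Z" for t
      using "0.prems"(5)[OF that] by (simp only: p poly_pCons poly_0 mult_zero_right add_0_right)
  qed (use "0.prems" in blast)+
  then show ?case using p by simp
next
  case (Suc d)
  define h where "h t = poly p t + (\<Sum>j=1..k. a j * cos (real j * t) + b j * sin (real j * t))" for t
  define h' where "h' t = poly (pderiv p) t +
    (\<Sum>j=1..k. (real j * b j) * cos (real j * t) + (- real j * a j) * sin (real j * t))" for t
  have summand: "((\<lambda>t. a j * cos (real j * t) + b j * sin (real j * t)) has_real_derivative
      (real j * b j) * cos (real j * t) + (- real j * a j) * sin (real j * t)) (at t)" for j t
    by (auto intro!: derivative_eq_intros)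
  have der: "(h has_real_derivative h' t) (at t)" for t
    unfolding h_def h'_def by (intro DERIV_add poly_DERIV DERIV_sum[OF summand])
  have "Z \<noteq> {}" using Suc.prems(4) by auto
  then obtain Z' where Z': "finite Z'" "card Z = Suc (card Z')"
    "\<forall>z\<in>Z'. h' z = 0 \<and> Min Z < z \<and> z < Max Z"
    using Rolle_card[OF Suc.prems(2) _ _ der] Suc.prems(5) by (auto simp: h_def)
  have "Min Z \<in> {0<..<2 * pi}" "Max Z \<in> {0<..<2 * pi}"
    using \<open>Z \<noteq> {}\<close> Suc.prems(2,3) by (meson Min_in Max_in subsetD)+
  then have "Z' \<subseteq> {0<..<2 * pi}" using Z'(3) by force
  moreover have "degree (pderiv p) \<le> d" using Suc.prems(1) by (simp add: degree_pderiv)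
  moreover have "d + 2 * k + 1 \<le> card Z'" using Z'(2) Suc.prems(4) by simp
  ultimately have 0: "pderiv p = 0 \<and> (\<forall>j\<in>{1..k}. real j * b j = 0 \<and> - real j * a j = 0)"
    using Z'(1,3) by (intro Suc.IH[of _ Z']) (simp_all only: h'_def)
  \<comment> \<open>Since \<open>j\<close> is at least 1, the factor \<open>real j\<close>
    introduced by differentiation can be cancelled.\<close>
  then have ab: "\<forall>j\<in>{1..k}. a j = 0 \<and> b j = 0" by auto
  have "degree p = 0" using 0 by (simp add: pderiv_eq_0_iff)
  then obtain c where p: "p = [:c:]" by (rule degree_eq_zeroE)
  \<comment> \<open>A single zero recovers the constant that differentiation lost.\<close>
  obtain z where "z \<in> Z" using \<open>Z \<noteq> {}\<close> by blast
  then have "c = 0" using Suc.prems(5)[of z] ab p by simp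
  then show ?case using ab p by simp
qed

lemma sum_lessThan_double: "(\<Sum>i<2 * k. g i) = (\<Sum>j=1..k. g (2 * (j - 1)) + g (2 * (j - 1) + 1))"
  for g :: "nat \<Rightarrow> 'a::comm_monoid_add"
  by (induction k) (simp_all add: add.assoc)

lemma chebyshev_curve_mixed_moment_curve:
  "chebyshev_curve {0<..<2 * pi} (d + 2 * k) (mixed_moment_curve d k)"
proof
  show "is_interval {0<..<2 * pi}" "infinite {0<..<2 * pi}"
    by (simp_all add: infinite_Ioo)
  show "continuous_on {0<..<2 * pi} (\<lambda>t. mixed_moment_curve d k t i)" for i
  proof -
    consider "i < d" | "d \<le> i" "i < d + 2 * k" "even (i - d)"
      | "d \<le> i" "i < d + 2 * k" "odd (i - d)" | "d + 2 * k \<le> i" by linarith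
    then show ?thesis
      by cases (simp_all add: mixed_moment_curve_def Let_def continuous_intros)
  qed
  show "mixed_moment_curve d k t i = 0" if "d + 2 * k \<le> i" for i t
    using that by (simp add: mixed_moment_curve_def)
  fix Z :: "real set" and w0 :: real and w :: "nat \<Rightarrow> real"
  assume Z: "Z \<subseteq> {0<..<2 * pi}" "finite Z" "card Z = d + 2 * k + 1"
    and zero: "\<And>t. t \<in> Z \<Longrightarrow> w0 + (\<Sum>i<d + 2 * k. w i * mixed_moment_curve d k t i) = 0"
  \<comment> \<open>Coordinate \<open>i\<close> is the power \<open>i + 1\<close>, so
    \<open>pCons\<close> shifts the coefficients and takes \<open>w0\<close> as the constant
    term.\<close>
  define p where "p = pCons w0 (\<Sum>i<d. monom (w i) i)"
  define a where "a j = w (d + 2 * (j - 1))" for j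
  define b where "b j = w (d + 2 * (j - 1) + 1)" for j
  have eq: "w0 + (\<Sum>i<d + 2 * k. w i * mixed_moment_curve d k t i) =
      poly p t + (\<Sum>j=1..k. a j * cos (real j * t) + b j * sin (real j * t))" for t
  proof -
    have "(\<Sum>i<d + n. G i) = (\<Sum>i<d. G i) + (\<Sum>i<n. G (d + i))" for G :: "nat \<Rightarrow> real" and n
      by (induction n) (simp_all add: add.assoc)
    then have "(\<Sum>i<d + 2 * k. w i * mixed_moment_curve d k t i) =
        (\<Sum>i<d. w i * mixed_moment_curve d k t i) +
        (\<Sum>i<2 * k. w (d + i) * mixed_moment_curve d k t (d + i))" .
    also have "(\<Sum>i<d. w i * mixed_moment_curve d k t i) = t * (\<Sum>i<d. w i * t ^ i)"
      unfolding sum_distrib_left by (intro sum.cong) (auto simp: mixed_moment_curve_def)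
    also have "(\<Sum>i<2 * k. w (d + i) * mixed_moment_curve d k t (d + i)) =
        (\<Sum>j=1..k. a j * cos (real j * t) + b j * sin (real j * t))"
      unfolding sum_lessThan_double
      using mixed_moment_curve_cos[of _ k d t] mixed_moment_curve_sin[of _ k d t]
      by (intro sum.cong) (simp_all add: a_def b_def)
    finally show ?thesis by (simp add: p_def poly_sum poly_monom)
  qed
  have deg: "degree p \<le> d"
  proof (cases d)
    case (Suc n)
    then have "degree (\<Sum>i<d. monom (w i) i) \<le> n"
      by (intro degree_sum_le order.trans[OF degree_monom_le]) auto
    then show ?thesis using Suc by (simp add: p_def)
  qed (simp add: p_def)
  have 0: "p = 0 \<and> (\<forall>j\<in>{1..k}. a j = 0 \<and> b j = 0)"
    by (rule mixed_poly_zeros[OF deg Z(2,1) eq_refl[OF Z(3)[symmetric]] zero[unfolded eq]])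
  have "w i = 0" if i: "i < d + 2 * k" for i
  proof (cases "i < d")
    case True
    have "coeff p (Suc i) = w i" using True by (simp add: p_def coeff_sum)
    then show ?thesis using 0 by simp
  next
    case False
    \<comment> \<open>\<open>j\<close> is the frequency of coordinate \<open>i\<close>; the parity
      of \<open>i - d\<close> decides between cosine and sine.\<close>
    define j where "j = (i - d) div 2 + 1"
    have j: "j \<in> {1..k}" using False i by (auto simp: j_def)
    have "i = d + 2 * (j - 1) \<or> i = d + 2 * (j - 1) + 1" using False by (auto simp: j_def)
    then show ?thesis using 0 j by (auto simp: a_def b_def)
  qed
  moreover have "w0 = 0" using 0 by (simp add: p_def)
  ultimately show "w0 = 0 \<and> (\<forall>i<d + 2 * k. w i = 0)" by blast
qed

section \<open>Comparison with the moment curve\<close>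

lemma moment_curve_eq_mixed_moment_curve: "moment_curve D = mixed_moment_curve D 0"
  by (simp add: fun_eq_iff moment_curve_def mixed_moment_curve_def)

theorem theorem5:
  fixes d k :: nat and S :: "(nat \<Rightarrow> real) set"
  assumes "finite S"
    and "S \<subseteq> mixed_moment_curve d k ` {0<..<2 * pi}"
  shows "cyclic_polytope (d + 2 * k) (convex hull S)"
proof -
  \<comment> \<open>The parameters of \<open>S\<close> also serve on the moment curve: both curves
    are Chebyshev on the same interval with the same dimension, so closedness transfers in both
    directions.\<close>
  obtain T where T: "finite T" "T \<subseteq> {0<..<2 * pi}" "S = mixed_moment_curve d k ` T"
    using finite_subset_image[OF assms] by blast
  note curve = chebyshev_curve_mixed_moment_curve[of d k]
  have "chebyshev_curve {0<..<2 * pi} (d + 2 * k) (moment_curve (d + 2 * k))"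
    using chebyshev_curve_mixed_moment_curve[of "d + 2 * k" 0]
    by (simp add: moment_curve_eq_mixed_moment_curve)
  then have "combinatorially_equivalent (convex hull S) (convex hull (moment_curve (d + 2 * k) ` T))"
    unfolding T(3) using curve T(1,2)
    by (intro combinatorially_equivalentI) (blast intro: relation_closed_transfer)+
  moreover have "polytope (convex hull S)" using assms(1) unfolding polytope_def by blast
  ultimately show ?thesis unfolding cyclic_polytope_def using T(1) by blast
qed

end
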